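(* Let $d\in\mathbb{N}$, let $f:\mathbb{R}^n\to\mathbb{R}^n$ be a polynomial vector field of degree at most $d_f$, let $g_i$ be real polynomials in $x\in\mathbb{R}^n$ of degree at most $d_i$ (finitely many $i$), and define $\Omega:=\{x\in\mathbb{R}^n\mid g_i(x)\ge0\ \forall i\}$. If $V$ (a polynomial, together with $k$ and $\gamma$) solves the optimization problem $$\begin{aligned}\max_{k\ge0,\ \gamma>0,\ V}\quad & k\\ \text{s.t.}\quad & V(x)-(x^Tx)^d\in\Sigma_{s,2d}[\Omega],\\ & \gamma(x^Tx)^d-V(x)\in\Sigma_{s,2d}[\Omega],\\ & -2dkV(x)-\nabla V(x)^Tf(x)\in\Sigma_{s,d'}[\Omega],\end{aligned}$$ where $d'=\max\{2d,2d-1+d_f\}$, then for any $c\in\mathbb{R}_+$ such that $S_c(V)\subseteq\mathrm{int}(\Omega)$, $f$ is exponentially stable on $S_c(V)$ with rate $k$ and gain $M=\gamma^{\frac1{2d}}$.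
   Context: $\mathbb{R}_+=[0,\infty)$. $S_c(V):=\{x\in\mathbb{R}^n\mid V(x)\le c\}$. $\Sigma_{s,d}$ denotes sum-of-squares polynomials of degree at most $d$: for even $d$, $p\in\Sigma_{s,d}$ means $p(x)=Z_{d/2}(x)^TPZ_{d/2}(x)$ for some positive semidefinite matrix $P$, where $Z_{d/2}$ is the vector of monomials of degree $d/2$ or less. For $\Omega=\{x\mid g_i(x)\ge0\ \forall i\}$ with $g_i$ of degree at most $d_i$, $p\in\Sigma_{s,d}[\Omega]$ means $p(x)=s_0(x)+\sum_is_i(x)g_i(x)$ for some $s_0\in\Sigma_{s,d}$ and $s_i\in\Sigma_{s,d-d_i}$ (with $s_i=0$ if $d-d_i<0$). For a vector field $f$, $\phi_f$ denotes the solution map: $\partial_t\phi_f(x,t)=f(\phi_f(x,t))$, $\phi_f(x,0)=x$, assumed throughout well-defined, unique and jointly continuous. $f$ is exponentially stable on a set $G$ with rate $k\ge0$ and gain $M\ge1$ if $\|\phi_f(x,t)\|_2\le Me^{-kt}\|x\|_2$ for all $x\in G$, $t\ge0$. *)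

theory Defs
  imports "HOL-Analysis.Analysis"
begin

text \<open>
  Over the infinite field of reals a polynomial is determined by the function it induces, so
  polynomials in \<open>n\<close> variables are rendered as functions on \<open>real ^ 'n\<close>.
  A multi-index is a function \<open>\<alpha> :: 'n \<Rightarrow> nat\<close>.
\<close>

definition multi_indices :: "nat \<Rightarrow> ('n::finite \<Rightarrow> nat) set" where
  "multi_indices m = {\<alpha>. (\<Sum>i\<in>UNIV. \<alpha> i) \<le> m}"

definition monomial :: "('n::finite \<Rightarrow> nat) \<Rightarrow> real ^ 'n \<Rightarrow> real" where
  "monomial \<alpha> x = (\<Prod>i\<in>UNIV. (x $ i) ^ \<alpha> i)"

definition poly_deg_le :: "nat \<Rightarrow> (real ^ 'n::finite \<Rightarrow> real) \<Rightarrow> bool" where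
  "poly_deg_le m p \<longleftrightarrow> (\<exists>c. \<forall>x. p x = (\<Sum>\<alpha>\<in>multi_indices m. c \<alpha> * monomial \<alpha> x))"

text \<open>Sums over \<^term>\<open>multi_indices m\<close> are not degenerate:\<close>

lemma finite_multi_indices: "finite (multi_indices m :: ('n::finite \<Rightarrow> nat) set)"
proof (rule finite_subset)
  show "multi_indices m \<subseteq> (PiE UNIV (\<lambda>_. {..m}) :: ('n \<Rightarrow> nat) set)"
  proof
    fix \<alpha> :: "'n \<Rightarrow> nat"
    assume "\<alpha> \<in> multi_indices m"
    moreover have "\<alpha> i \<le> (\<Sum>i\<in>UNIV. \<alpha> i)" for i
      by (rule member_le_sum) auto
    ultimately show "\<alpha> \<in> PiE UNIV (\<lambda>_. {..m})"
      by (auto simp: multi_indices_def intro: order_trans)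
  qed
  show "finite (PiE UNIV (\<lambda>_. {..m}) :: ('n \<Rightarrow> nat) set)"
    by (rule finite_PiE) auto
qed

definition psd_on :: "'a set \<Rightarrow> ('a \<Rightarrow> 'a \<Rightarrow> real) \<Rightarrow> bool" where
  "psd_on A P \<longleftrightarrow>
     (\<forall>a\<in>A. \<forall>b\<in>A. P a b = P b a) \<and>
     (\<forall>v. 0 \<le> (\<Sum>a\<in>A. \<Sum>b\<in>A. v a * P a b * v b))"

text \<open>
  For even \<open>d\<close> this is the Gram matrix form with the vector of all monomials of degree at most
  \<open>d / 2\<close>. A sum of squares of real polynomials has even degree, so for odd \<open>d\<close>
  the sums of squares of degree at most \<open>d\<close> are those of degree at most \<open>d - 1\<close>;
  truncating division covers both cases.
\<close>

definition sos :: "nat \<Rightarrow> (real ^ 'n::finite \<Rightarrow> real) set" where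
  "sos d = {p. \<exists>P. psd_on (multi_indices (d div 2)) P \<and>
     (\<forall>x. p x = (\<Sum>\<alpha>\<in>multi_indices (d div 2). \<Sum>\<beta>\<in>multi_indices (d div 2).
                     monomial \<alpha> x * P \<alpha> \<beta> * monomial \<beta> x))}"

definition semialg :: "'i set \<Rightarrow> ('i \<Rightarrow> real ^ 'n::finite \<Rightarrow> real) \<Rightarrow> (real ^ 'n) set" where
  "semialg I g = {x. \<forall>i\<in>I. 0 \<le> g i x}"

text \<open>
  The truncated cone depends on the chosen description of the semialgebraic set: on the
  polynomials \<open>g i\<close> and on their degree bounds \<open>dg i\<close>.
\<close>

definition sos_cone ::
  "'i set \<Rightarrow> ('i \<Rightarrow> real ^ 'n::finite \<Rightarrow> real) \<Rightarrow> ('i \<Rightarrow> nat) \<Rightarrow> nat \<Rightarrow> (real ^ 'n \<Rightarrow> real) set" where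
  "sos_cone I g dg d = {p. \<exists>s0 s. s0 \<in> sos d \<and>
     (\<forall>i\<in>I. if d < dg i then s i = (\<lambda>x. 0) else s i \<in> sos (d - dg i)) \<and>
     (\<forall>x. p x = s0 x + (\<Sum>i\<in>I. s i x * g i x))}"

definition gradient :: "(real ^ 'n::finite \<Rightarrow> real) \<Rightarrow> real ^ 'n \<Rightarrow> real ^ 'n" where
  "gradient V x = (THE D. GDERIV V x :> D)"

definition feasible ::
  "nat \<Rightarrow> nat \<Rightarrow> (real ^ 'n::finite \<Rightarrow> real ^ 'n) \<Rightarrow>
   'i set \<Rightarrow> ('i \<Rightarrow> real ^ 'n \<Rightarrow> real) \<Rightarrow> ('i \<Rightarrow> nat) \<Rightarrow>
   real \<Rightarrow> real \<Rightarrow> (real ^ 'n \<Rightarrow> real) \<Rightarrow> bool" where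
  "feasible d df f I g dg k \<gamma> V \<longleftrightarrow>
     0 \<le> k \<and> 0 < \<gamma> \<and> (\<exists>m. poly_deg_le m V) \<and>
     (\<lambda>x. V x - (x \<bullet> x) ^ d) \<in> sos_cone I g dg (2 * d) \<and>
     (\<lambda>x. \<gamma> * (x \<bullet> x) ^ d - V x) \<in> sos_cone I g dg (2 * d) \<and>
     (\<lambda>x. - 2 * real d * k * V x - gradient V x \<bullet> f x)
        \<in> sos_cone I g dg (max (2 * d) (2 * d - 1 + df))"

definition solves ::
  "nat \<Rightarrow> nat \<Rightarrow> (real ^ 'n::finite \<Rightarrow> real ^ 'n) \<Rightarrow>
   'i set \<Rightarrow> ('i \<Rightarrow> real ^ 'n \<Rightarrow> real) \<Rightarrow> ('i \<Rightarrow> nat) \<Rightarrow>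
   real \<Rightarrow> real \<Rightarrow> (real ^ 'n \<Rightarrow> real) \<Rightarrow> bool" where
  "solves d df f I g dg k \<gamma> V \<longleftrightarrow>
     feasible d df f I g dg k \<gamma> V \<and>
     (\<forall>k' \<gamma>' V'. feasible d df f I g dg k' \<gamma>' V' \<longrightarrow> k' \<le> k)"

definition solves_ivp ::
  "('a::real_normed_vector \<Rightarrow> 'a) \<Rightarrow> 'a \<Rightarrow> (real \<Rightarrow> 'a) \<Rightarrow> bool" where
  "solves_ivp f x u \<longleftrightarrow>
     u 0 = x \<and> (\<forall>t\<ge>0. (u has_vector_derivative f (u t)) (at t within {0..}))"

definition solution_map ::
  "('a::real_normed_vector \<Rightarrow> 'a) \<Rightarrow> ('a \<Rightarrow> real \<Rightarrow> 'a) \<Rightarrow> bool" where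
  "solution_map f \<phi> \<longleftrightarrow>
     (\<forall>x. solves_ivp f x (\<phi> x)) \<and>
     (\<forall>x u. solves_ivp f x u \<longrightarrow> (\<forall>t\<ge>0. u t = \<phi> x t)) \<and>
     continuous_on (UNIV \<times> {0..}) (\<lambda>(x, t). \<phi> x t)"

text \<open>Here \<open>\<phi>\<close> is the solution map of the vector field whose stability is asserted.\<close>

definition exponentially_stable_on ::
  "('a::real_normed_vector \<Rightarrow> real \<Rightarrow> 'a) \<Rightarrow> 'a set \<Rightarrow> real \<Rightarrow> real \<Rightarrow> bool" where
  "exponentially_stable_on \<phi> G k M \<longleftrightarrow>
     0 \<le> k \<and> 1 \<le> M \<and>
     (\<forall>x\<in>G. \<forall>t\<ge>0. norm (\<phi> x t) \<le> M * exp (- k * t) * norm x)"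

definition sublevel :: "('a \<Rightarrow> real) \<Rightarrow> real \<Rightarrow> 'a set" where
  "sublevel V c = {x. V x \<le> c}"

end

theory Submission
  imports Defs
begin

text \<open>
  Evaluating a truncated sum-of-squares certificate at a point of \<open>\<Omega>\<close> gives a nonnegative
  number, so on \<open>\<Omega>\<close> the three constraints become the Lyapunov inequalities
  \<open>(x \<bullet> x)^d \<le> V x \<le> \<gamma> (x \<bullet> x)^d\<close> and \<open>\<nabla>V x \<bullet> f x \<le> - 2 d k V x\<close>. In particular \<open>V\<close> is
  nonnegative on \<open>\<Omega>\<close> and does not increase along a trajectory while it is in \<open>\<Omega>\<close>. Since
  \<open>S_c(V)\<close> lies in the open set \<open>int \<Omega>\<close>, a trajectory that leaves \<open>S_c(V)\<close> would have to
  increase \<open>V\<close> while still in \<open>int \<Omega>\<close>; hence \<open>S_c(V)\<close> is forward invariant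
  (\<open>sublevel_forward_invariant\<close>). The differential inequality then holds for all times and
  integrates to \<open>V (\<phi> x t) \<le> exp (- 2 d k t) V x\<close> (\<open>decay_along_solution\<close>). Sandwiching \<open>V\<close>
  between the multiples of \<open>(x \<bullet> x)^d\<close> and taking \<open>2 d\<close>-th roots gives the bound on the norm.

  The gain has to be at least 1, that is \<open>\<gamma> \<ge> 1\<close>. Comparing the two bounds on \<open>V\<close> at a
  nonzero point of \<open>\<Omega>\<close> gives this only if there is such a point. Optimality of \<open>k\<close> settles
  all cases at once (\<open>solves_gain_ge_one\<close>): if \<open>\<gamma> < 1\<close>, then adding the first two
  certificates shows that \<open>- (x \<bullet> x)^d\<close> is in the truncated cone, hence so is \<open>- V\<close>, and
  multiples of it may be added to the third certificate, so that every larger rate is feasible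
  too and no maximum exists.
\<close>

section \<open>Truncated sums of squares and their cones\<close>

lemma sos_nonneg: "p \<in> sos d \<Longrightarrow> 0 \<le> p x"
  by (auto simp: sos_def psd_on_def)

lemma sos_zero: "(\<lambda>x. 0) \<in> sos d"
  unfolding sos_def psd_on_def by (auto intro!: exI[of _ "\<lambda>_ _. 0"])

lemma sos_add:
  assumes "p \<in> sos d" and "q \<in> sos d"
  shows "(\<lambda>x. p x + q x) \<in> sos d"
proof -
  let ?A = "multi_indices (d div 2)"
  obtain P Q where P: "psd_on ?A P" and Q: "psd_on ?A Q"
    and p: "\<And>x. p x = (\<Sum>\<alpha>\<in>?A. \<Sum>\<beta>\<in>?A. monomial \<alpha> x * P \<alpha> \<beta> * monomial \<beta> x)"
    and q: "\<And>x. q x = (\<Sum>\<alpha>\<in>?A. \<Sum>\<beta>\<in>?A. monomial \<alpha> x * Q \<alpha> \<beta> * monomial \<beta> x)"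
    using assms unfolding sos_def by blast
  have eq: "(\<Sum>\<alpha>\<in>?A. \<Sum>\<beta>\<in>?A. v \<alpha> * (P \<alpha> \<beta> + Q \<alpha> \<beta>) * v \<beta>)
      = (\<Sum>\<alpha>\<in>?A. \<Sum>\<beta>\<in>?A. v \<alpha> * P \<alpha> \<beta> * v \<beta>) + (\<Sum>\<alpha>\<in>?A. \<Sum>\<beta>\<in>?A. v \<alpha> * Q \<alpha> \<beta> * v \<beta>)" for v
    by (simp add: distrib_left distrib_right sum.distrib)
  have "psd_on ?A (\<lambda>\<alpha> \<beta>. P \<alpha> \<beta> + Q \<alpha> \<beta>)"
    using P Q unfolding psd_on_def eq by simp
  moreover have "\<forall>x. p x + q x
      = (\<Sum>\<alpha>\<in>?A. \<Sum>\<beta>\<in>?A. monomial \<alpha> x * (P \<alpha> \<beta> + Q \<alpha> \<beta>) * monomial \<beta> x)"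
    by (simp only: p q eq simp_thms)
  ultimately show ?thesis unfolding sos_def by blast
qed

lemma sos_scale:
  assumes "p \<in> sos d" and "0 \<le> a"
  shows "(\<lambda>x. a * p x) \<in> sos d"
proof -
  let ?A = "multi_indices (d div 2)"
  obtain P where P: "psd_on ?A P"
    and p: "\<And>x. p x = (\<Sum>\<alpha>\<in>?A. \<Sum>\<beta>\<in>?A. monomial \<alpha> x * P \<alpha> \<beta> * monomial \<beta> x)"
    using assms unfolding sos_def by blast
  have eq: "(\<Sum>\<alpha>\<in>?A. \<Sum>\<beta>\<in>?A. v \<alpha> * (a * P \<alpha> \<beta>) * v \<beta>)
      = a * (\<Sum>\<alpha>\<in>?A. \<Sum>\<beta>\<in>?A. v \<alpha> * P \<alpha> \<beta> * v \<beta>)" for v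
    by (simp add: sum_distrib_left mult_ac)
  have "psd_on ?A (\<lambda>\<alpha> \<beta>. a * P \<alpha> \<beta>)"
    using P \<open>0 \<le> a\<close> unfolding psd_on_def eq by auto
  then show ?thesis
    unfolding sos_def by (intro CollectI exI[of _ "\<lambda>\<alpha> \<beta>. a * P \<alpha> \<beta>"] conjI) (simp_all only: eq p simp_thms)
qed

lemma sos_mono:
  assumes p: "p \<in> sos d" and le: "d \<le> e"
  shows "p \<in> sos e"
proof -
  let ?A = "multi_indices (d div 2)" and ?B = "multi_indices (e div 2)"
  obtain P where P: "psd_on ?A P"
    and p: "\<And>x. p x = (\<Sum>\<alpha>\<in>?A. \<Sum>\<beta>\<in>?A. monomial \<alpha> x * P \<alpha> \<beta> * monomial \<beta> x)"
    using p unfolding sos_def by blast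
  have sub: "?A \<subseteq> ?B"
    using div_le_mono[OF le, of 2] by (auto simp: multi_indices_def)
  define Q where "Q \<alpha> \<beta> = (if \<alpha> \<in> ?A \<and> \<beta> \<in> ?A then P \<alpha> \<beta> else 0)" for \<alpha> \<beta>
  have eq: "(\<Sum>\<alpha>\<in>?B. \<Sum>\<beta>\<in>?B. v \<alpha> * Q \<alpha> \<beta> * v \<beta>)
      = (\<Sum>\<alpha>\<in>?A. \<Sum>\<beta>\<in>?A. v \<alpha> * P \<alpha> \<beta> * v \<beta>)" for v
  proof -
    have "(\<Sum>\<alpha>\<in>?B. \<Sum>\<beta>\<in>?B. v \<alpha> * Q \<alpha> \<beta> * v \<beta>) = (\<Sum>\<alpha>\<in>?A. \<Sum>\<beta>\<in>?B. v \<alpha> * Q \<alpha> \<beta> * v \<beta>)"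
      by (rule sum.mono_neutral_right) (auto simp: Q_def finite_multi_indices intro: subsetD[OF sub])
    also have "\<dots> = (\<Sum>\<alpha>\<in>?A. \<Sum>\<beta>\<in>?A. v \<alpha> * P \<alpha> \<beta> * v \<beta>)"
      by (intro sum.cong refl sum.mono_neutral_cong_right)
        (auto simp: Q_def finite_multi_indices intro: subsetD[OF sub])
    finally show ?thesis .
  qed
  have "psd_on ?B Q"
    using P unfolding psd_on_def eq by (auto simp: Q_def)
  then show ?thesis
    unfolding sos_def by (intro CollectI exI[of _ Q] conjI) (simp_all only: eq p simp_thms)
qed

lemma sos_cone_nonneg:
  assumes "p \<in> sos_cone I g dg d" and "x \<in> semialg I g"
  shows "0 \<le> p x"
proof -
  obtain s0 s where "s0 \<in> sos d"
    and s: "\<And>i. i \<in> I \<Longrightarrow> if d < dg i then s i = (\<lambda>x. 0) else s i \<in> sos (d - dg i)"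
    and p: "p x = s0 x + (\<Sum>i\<in>I. s i x * g i x)"
    using assms(1) unfolding sos_cone_def by blast
  have "0 \<le> s i x" if "i \<in> I" for i
    using s[OF that] by (auto split: if_splits intro: sos_nonneg)
  then have "0 \<le> (\<Sum>i\<in>I. s i x * g i x)"
    using assms(2) by (auto simp: semialg_def intro!: sum_nonneg mult_nonneg_nonneg)
  then show ?thesis
    using p sos_nonneg[OF \<open>s0 \<in> sos d\<close>, of x] by simp
qed

lemma sos_cone_add:
  assumes "p \<in> sos_cone I g dg d" and "q \<in> sos_cone I g dg d"
  shows "(\<lambda>x. p x + q x) \<in> sos_cone I g dg d"
proof -
  obtain s0 s where s0: "s0 \<in> sos d"
    and s: "\<forall>i\<in>I. if d < dg i then s i = (\<lambda>x. 0) else s i \<in> sos (d - dg i)"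
    and p: "\<And>x. p x = s0 x + (\<Sum>i\<in>I. s i x * g i x)"
    using assms(1) unfolding sos_cone_def by blast
  obtain t0 t where t0: "t0 \<in> sos d"
    and t: "\<forall>i\<in>I. if d < dg i then t i = (\<lambda>x. 0) else t i \<in> sos (d - dg i)"
    and q: "\<And>x. q x = t0 x + (\<Sum>i\<in>I. t i x * g i x)"
    using assms(2) unfolding sos_cone_def by blast
  have "\<forall>i\<in>I. if d < dg i then (\<lambda>x. s i x + t i x) = (\<lambda>x. 0)
      else (\<lambda>x. s i x + t i x) \<in> sos (d - dg i)"
    using s t by (auto intro: sos_add)
  moreover have "p x + q x = (s0 x + t0 x) + (\<Sum>i\<in>I. (s i x + t i x) * g i x)" for x
    by (simp add: p q distrib_right sum.distrib)
  ultimately show ?thesis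
    using sos_add[OF s0 t0] unfolding sos_cone_def
    by (intro CollectI exI[of _ "\<lambda>x. s0 x + t0 x"] exI[of _ "\<lambda>i x. s i x + t i x"]) auto
qed

lemma sos_cone_scale:
  assumes "p \<in> sos_cone I g dg d" and "0 \<le> a"
  shows "(\<lambda>x. a * p x) \<in> sos_cone I g dg d"
proof -
  obtain s0 s where s0: "s0 \<in> sos d"
    and s: "\<forall>i\<in>I. if d < dg i then s i = (\<lambda>x. 0) else s i \<in> sos (d - dg i)"
    and p: "\<And>x. p x = s0 x + (\<Sum>i\<in>I. s i x * g i x)"
    using assms(1) unfolding sos_cone_def by blast
  have "\<forall>i\<in>I. if d < dg i then (\<lambda>x. a * s i x) = (\<lambda>x. 0)
      else (\<lambda>x. a * s i x) \<in> sos (d - dg i)"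
    using s \<open>0 \<le> a\<close> by (auto intro: sos_scale)
  moreover have "a * p x = a * s0 x + (\<Sum>i\<in>I. (a * s i x) * g i x)" for x
    by (simp add: p distrib_left sum_distrib_left mult_ac)
  ultimately show ?thesis
    using sos_scale[OF s0 \<open>0 \<le> a\<close>] unfolding sos_cone_def
    by (intro CollectI exI[of _ "\<lambda>x. a * s0 x"] exI[of _ "\<lambda>i x. a * s i x"]) auto
qed

lemma sos_cone_mono:
  assumes "p \<in> sos_cone I g dg d" and "d \<le> e"
  shows "p \<in> sos_cone I g dg e"
proof -
  obtain s0 s where s0: "s0 \<in> sos d"
    and s: "\<forall>i\<in>I. if d < dg i then s i = (\<lambda>x. 0) else s i \<in> sos (d - dg i)"
    and p: "\<And>x. p x = s0 x + (\<Sum>i\<in>I. s i x * g i x)"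
    using assms(1) unfolding sos_cone_def by blast
  have "if e < dg i then s i = (\<lambda>x. 0) else s i \<in> sos (e - dg i)" if "i \<in> I" for i
    using bspec[OF s that] \<open>d \<le> e\<close>
    by (auto split: if_splits intro: sos_zero sos_mono)
  with p sos_mono[OF s0 \<open>d \<le> e\<close>] show ?thesis
    unfolding sos_cone_def by blast
qed

section \<open>Optimality forces the gain to be at least one\<close>

text \<open>
  A value \<open>\<gamma> < 1\<close> can only occur if \<open>\<Omega>\<close> has no nonzero point, and then the values of the
  certificates on \<open>\<Omega>\<close> say nothing about \<open>\<gamma>\<close>. The argument therefore works in the cone itself and contradicts
  optimality by exhibiting the feasible rate \<open>k + 1\<close>, with the same \<open>\<gamma>\<close> and \<open>V\<close>.
\<close>

lemma solves_gain_ge_one: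
  assumes "solves d df f I g dg k \<gamma> V"
  shows "1 \<le> \<gamma>"
proof (rule ccontr)
  assume "\<not> 1 \<le> \<gamma>"
  then have lt: "\<gamma> < 1" by simp
  let ?C = "sos_cone I g dg (2 * d)"
  let ?C' = "sos_cone I g dg (max (2 * d) (2 * d - 1 + df))"
  have feas: "feasible d df f I g dg k \<gamma> V"
    and opt: "\<And>k' \<gamma>' V'. feasible d df f I g dg k' \<gamma>' V' \<Longrightarrow> k' \<le> k"
    using assms unfolding solves_def by blast+
  from feas have "0 < \<gamma>" and "0 \<le> k" and poly: "\<exists>m. poly_deg_le m V"
    and lower: "(\<lambda>x. V x - (x \<bullet> x) ^ d) \<in> ?C"
    and upper: "(\<lambda>x. \<gamma> * (x \<bullet> x) ^ d - V x) \<in> ?C"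
    and decr: "(\<lambda>x. - 2 * real d * k * V x - gradient V x \<bullet> f x) \<in> ?C'"
    unfolding feasible_def by blast+
  have "(\<lambda>x. \<gamma> / (1 - \<gamma>) * ((V x - (x \<bullet> x) ^ d) + (\<gamma> * (x \<bullet> x) ^ d - V x))) \<in> ?C"
    using lt \<open>0 < \<gamma>\<close> by (intro sos_cone_scale sos_cone_add lower upper) simp
  also have "(\<lambda>x. \<gamma> / (1 - \<gamma>) * ((V x - (x \<bullet> x) ^ d) + (\<gamma> * (x \<bullet> x) ^ d - V x)))
      = (\<lambda>x. - \<gamma> * (x \<bullet> x) ^ d)"
    using lt by (intro ext) (simp add: field_simps)
  finally have "(\<lambda>x. (\<gamma> * (x \<bullet> x) ^ d - V x) + (- \<gamma> * (x \<bullet> x) ^ d)) \<in> ?C"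
    by (rule sos_cone_add[OF upper])
  then have "(\<lambda>x. - V x) \<in> ?C" by simp
  then have "(\<lambda>x. - V x) \<in> ?C'" by (rule sos_cone_mono) simp
  then have "(\<lambda>x. (- 2 * real d * k * V x - gradient V x \<bullet> f x) + 2 * real d * (- V x)) \<in> ?C'"
    by (intro sos_cone_add decr sos_cone_scale) simp_all
  also have "(\<lambda>x. (- 2 * real d * k * V x - gradient V x \<bullet> f x) + 2 * real d * (- V x))
      = (\<lambda>x. - 2 * real d * (k + 1) * V x - gradient V x \<bullet> f x)"
    by (intro ext) (simp add: algebra_simps)
  finally have "feasible d df f I g dg (k + 1) \<gamma> V"
    unfolding feasible_def using \<open>0 < \<gamma>\<close> \<open>0 \<le> k\<close> poly lower upper by simp
  from opt[OF this] show False by simp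
qed

section \<open>Gradients of polynomials\<close>

lemma gderiv_gradient:
  fixes V :: "real ^ 'n::finite \<Rightarrow> real"
  assumes "V differentiable (at x)"
  shows "GDERIV V x :> gradient V x"
proof -
  obtain F where F: "(V has_derivative F) (at x)"
    using assms unfolding differentiable_def by blast
  interpret F: bounded_linear F using F by (rule has_derivative_bounded_linear)
  \<comment> \<open>The Riesz representative of the derivative.\<close>
  define D where "D = (\<Sum>b\<in>Basis. F b *\<^sub>R b)"
  have "F h = h \<bullet> D" for h
  proof -
    have "F h = F (\<Sum>b\<in>Basis. (h \<bullet> b) *\<^sub>R b)" by (simp add: euclidean_representation)
    also have "\<dots> = h \<bullet> D"
      by (simp add: D_def F.sum F.scaleR inner_sum_right mult.commute)
    finally show ?thesis .
  qed
  then have "F = (\<lambda>h. h \<bullet> D)" ..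
  with F have D: "GDERIV V x :> D" by (simp add: gderiv_def)
  have "E = D" if "GDERIV V x :> E" for E
  proof -
    have "(\<lambda>h. h \<bullet> E) = (\<lambda>h. h \<bullet> D)"
      using that D unfolding gderiv_def by (rule has_derivative_unique)
    then have "\<And>h. h \<bullet> E = h \<bullet> D" by (rule fun_cong)
    then show ?thesis by (metis vector_eq_ldot)
  qed
  with D show ?thesis
    unfolding gradient_def by (rule theI)
qed

lemma poly_differentiable:
  fixes V :: "real ^ 'n::finite \<Rightarrow> real"
  assumes "poly_deg_le m V"
  shows "V differentiable (at x)"
proof -
  have mono: "monomial \<alpha> differentiable (at x)" for \<alpha> :: "'n \<Rightarrow> nat"
  proof -
    have "((\<lambda>y. \<Prod>i\<in>UNIV. (y $ i) ^ \<alpha> i) has_derivative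
        (\<lambda>h. \<Sum>i\<in>UNIV. (real (\<alpha> i) * (h $ i) * (x $ i) ^ (\<alpha> i - 1))
          * (\<Prod>j\<in>UNIV - {i}. (x $ j) ^ \<alpha> j))) (at x)"
      by (rule has_derivative_prod)
        (auto intro!: derivative_eq_intros bounded_linear.has_derivative[OF bounded_linear_vec_nth]
          simp: fun_eq_iff)
    then show ?thesis
      unfolding monomial_def[abs_def] differentiable_def by blast
  qed
  obtain c where "\<And>x. V x = (\<Sum>\<alpha>\<in>multi_indices m. c \<alpha> * monomial \<alpha> x)"
    using assms unfolding poly_deg_le_def by blast
  then have "V = (\<lambda>x. \<Sum>\<alpha>\<in>multi_indices m. c \<alpha> * monomial \<alpha> x)" by blast
  then show ?thesis
    using mono by (auto intro!: differentiable_sum differentiable_mult finite_multi_indices)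
qed

section \<open>Lyapunov functions along solutions\<close>

lemma has_real_derivative_along_solution:
  assumes "solves_ivp f x u" and "GDERIV V (u t) :> D" and "0 \<le> t"
  shows "((\<lambda>s. V (u s)) has_real_derivative D \<bullet> f (u t)) (at t within {0..})"
proof -
  have u: "(u has_derivative (\<lambda>h. h *\<^sub>R f (u t))) (at t within {0..})"
    using assms(1,3) by (simp add: solves_ivp_def has_vector_derivative_def)
  have V: "(V has_derivative (\<lambda>h. h \<bullet> D)) (at (u t))"
    using assms(2) by (simp add: gderiv_def)
  show ?thesis
    using has_derivative_compose[OF u V]
    by (simp add: has_field_derivative_def inner_commute mult.commute[of _ "D \<bullet> f (u t)"])
qed

lemma has_real_derivative_along_solution_at:
  assumes "solves_ivp f x u" and "GDERIV V (u t) :> D" and "0 < t"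
  shows "((\<lambda>s. V (u s)) has_real_derivative D \<bullet> f (u t)) (at t)"
proof -
  have "((\<lambda>s. V (u s)) has_real_derivative D \<bullet> f (u t)) (at t within {0<..})"
    by (rule DERIV_subset[OF has_real_derivative_along_solution[OF assms(1,2)]])
      (use \<open>0 < t\<close> in auto)
  then show ?thesis using \<open>0 < t\<close> by (simp add: at_within_open[of t "{0<..}"])
qed

lemma continuous_on_along_solution:
  assumes "solves_ivp f x u" and "\<And>y. GDERIV V y :> D y"
  shows "continuous_on {0..} (\<lambda>s. V (u s))"
  using has_real_derivative_along_solution[OF assms(1) assms(2)]
  by (auto intro!: DERIV_continuous simp: continuous_on_eq_continuous_within)

text \<open>
  Let \<open>r\<close> be the infimum of the times at which the solution is outside the sublevel set. By
  continuity it is still inside at time \<open>r\<close>, hence in the open set \<open>U\<close>, and remains in \<open>U\<close>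
  for a while; there \<open>V\<close> cannot increase, so that \<open>r\<close> is not the infimum.
\<close>

lemma sublevel_forward_invariant:
  assumes sol: "solves_ivp f x u" and V: "\<And>y. GDERIV V y :> D y"
    and "open U" and sub: "sublevel V c \<subseteq> U"
    and decr: "\<And>y. y \<in> U \<Longrightarrow> D y \<bullet> f y \<le> 0"
    and x: "x \<in> sublevel V c" and "0 \<le> t"
  shows "u t \<in> sublevel V c"
proof (rule ccontr)
  assume "u t \<notin> sublevel V c"
  define W where "W s = V (u s)" for s
  have cont: "continuous_on {0..} W"
    unfolding W_def by (rule continuous_on_along_solution[OF sol V])
  have contu: "continuous_on {0..} u"
    using sol unfolding solves_ivp_def continuous_on_eq_continuous_within
    by (auto intro: has_vector_derivative_continuous)
  define B where "B = {s. 0 \<le> s \<and> c < W s}"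
  define r where "r = Inf B"
  have t: "t \<in> B"
    using \<open>u t \<notin> sublevel V c\<close> \<open>0 \<le> t\<close> by (auto simp: B_def W_def sublevel_def)
  have bdd: "bdd_below B" by (auto simp: B_def bdd_below_def)
  have r0: "0 \<le> r"
    unfolding r_def using t by (intro cInf_greatest) (auto simp: B_def)
  have before: "W s \<le> c" if "0 \<le> s" "s < r" for s
    using that cInf_lower[OF _ bdd, of s] by (force simp: B_def r_def)
  have Wr: "W r \<le> c"
  proof (cases "r = 0")
    case True
    then show ?thesis
      using x sol by (simp add: W_def sublevel_def solves_ivp_def)
  next
    case False
    have "W s \<le> c" if "s \<in> closure {0..<r}" for s
    proof (rule continuous_le_on_closure[OF _ that])
      show "continuous_on (closure {0..<r}) W"
        using False r0 by (intro continuous_on_subset[OF cont]) auto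
    qed (use before in auto)
    then show ?thesis using False r0 by simp
  qed
  then have "u r \<in> U" using sub by (auto simp: W_def sublevel_def)
  then obtain e where "e > 0" and e: "\<And>y. dist y (u r) < e \<Longrightarrow> y \<in> U"
    using \<open>open U\<close> unfolding open_dist by blast
  then obtain \<delta> where "\<delta> > 0"
    and \<delta>: "\<And>s. 0 \<le> s \<Longrightarrow> dist s r < \<delta> \<Longrightarrow> dist (u s) (u r) < e"
    using contu r0 unfolding continuous_on_iff by force
  have "W b \<le> c" if "r \<le> b" "b < r + \<delta>" for b
  proof (cases "b = r")
    case False
    have "W b \<le> W r"
    proof (rule DERIV_nonpos_imp_decreasing_open[where f = W])
      show "r \<le> b" using that by simp
      show "continuous_on {r..b} W"
        using r0 by (intro continuous_on_subset[OF cont]) auto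
      fix s assume s: "r < s" "s < b"
      then have "0 < s" using r0 by simp
      have "(W has_real_derivative D (u s) \<bullet> f (u s)) (at s)"
        unfolding W_def by (rule has_real_derivative_along_solution_at[OF sol V \<open>0 < s\<close>])
      moreover have "D (u s) \<bullet> f (u s) \<le> 0"
        using s that \<open>0 < s\<close> by (intro decr e \<delta>) (auto simp: dist_real_def)
      ultimately show "\<exists>y. (W has_real_derivative y) (at s) \<and> y \<le> 0" by blast
    qed
    with Wr show ?thesis by simp
  qed (use Wr in simp)
  with before have "r + \<delta> \<le> s" if "s \<in> B" for s
    using that by (force simp: B_def not_less[symmetric])
  then have "r + \<delta> \<le> r"
    unfolding r_def using t by (intro cInf_greatest) auto
  with \<open>\<delta> > 0\<close> show False by simp
qed

text \<open>The differential inequality says that \<open>exp (a t) V (u t)\<close> does not increase.\<close>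

lemma decay_along_solution:
  assumes sol: "solves_ivp f x u" and V: "\<And>y. GDERIV V y :> D y"
    and decr: "\<And>s. 0 \<le> s \<Longrightarrow> D (u s) \<bullet> f (u s) \<le> - a * V (u s)"
    and "0 \<le> t"
  shows "V (u t) \<le> exp (- a * t) * V x"
proof -
  define W where "W s = V (u s)" for s
  have cont: "continuous_on {0..} W"
    unfolding W_def by (rule continuous_on_along_solution[OF sol V])
  have "exp (a * t) * W t \<le> exp (a * 0) * W 0"
  proof (rule DERIV_nonpos_imp_decreasing_open[where f = "\<lambda>s. exp (a * s) * W s"])
    show "0 \<le> t" by fact
    show "continuous_on {0..t} (\<lambda>s. exp (a * s) * W s)"
      by (intro continuous_intros continuous_on_subset[OF cont]) auto
    fix s assume s: "0 < s" "s < t"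
    have "(W has_real_derivative D (u s) \<bullet> f (u s)) (at s)"
      unfolding W_def by (rule has_real_derivative_along_solution_at[OF sol V s(1)])
    then have "((\<lambda>s. exp (a * s) * W s) has_real_derivative
        exp (a * s) * (D (u s) \<bullet> f (u s) + a * W s)) (at s)"
      by (auto intro!: derivative_eq_intros simp: algebra_simps)
    moreover have "exp (a * s) * (D (u s) \<bullet> f (u s) + a * W s) \<le> 0"
      using decr[of s] s by (intro mult_nonneg_nonpos) (auto simp: W_def)
    ultimately show "\<exists>y. ((\<lambda>s. exp (a * s) * W s) has_real_derivative y) (at s) \<and> y \<le> 0"
      by blast
  qed
  moreover have "u 0 = x" using sol by (simp add: solves_ivp_def)
  ultimately show ?thesis by (simp add: W_def exp_minus field_simps)
qed

section \<open>Exponential stability from sum-of-squares certificates\<close>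

theorem corollary24:
  fixes d df :: nat
    and f :: "real ^ 'n::finite \<Rightarrow> real ^ 'n"
    and \<phi> :: "real ^ 'n \<Rightarrow> real \<Rightarrow> real ^ 'n"
    and I :: "'i set"
    and g :: "'i \<Rightarrow> real ^ 'n \<Rightarrow> real"
    and dg :: "'i \<Rightarrow> nat"
    and V :: "real ^ 'n \<Rightarrow> real"
    and k \<gamma> c :: real
  assumes "1 \<le> d"
    and "\<And>j. poly_deg_le df (\<lambda>x. f x $ j)"
    and "solution_map f \<phi>"
    and "finite I"
    and "\<And>i. i \<in> I \<Longrightarrow> poly_deg_le (dg i) (g i)"
    and "solves d df f I g dg k \<gamma> V"
    and "0 \<le> c"
    and "sublevel V c \<subseteq> interior (semialg I g)"
  shows "exponentially_stable_on \<phi> (sublevel V c) k (\<gamma> powr (1 / (2 * real d)))"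
proof -
  let ?\<Omega> = "semialg I g" and ?M = "\<gamma> powr (1 / (2 * real d))"
  have feas: "feasible d df f I g dg k \<gamma> V"
    using assms(6) by (simp add: solves_def)
  then have "0 \<le> k" by (simp add: feasible_def)
  have "1 \<le> \<gamma>" by (rule solves_gain_ge_one[OF assms(6)])
  then have "1 \<le> ?M" by (simp add: ge_one_powr_ge_zero)
  have lower: "(x \<bullet> x) ^ d \<le> V x" if "x \<in> ?\<Omega>" for x
    using sos_cone_nonneg[OF _ that] feas unfolding feasible_def by fastforce
  have upper: "V x \<le> \<gamma> * (x \<bullet> x) ^ d" if "x \<in> ?\<Omega>" for x
    using sos_cone_nonneg[OF _ that] feas unfolding feasible_def by fastforce
  have decr: "gradient V x \<bullet> f x \<le> - (2 * real d * k) * V x" if "x \<in> ?\<Omega>" for x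
    using sos_cone_nonneg[OF _ that] feas unfolding feasible_def by fastforce
  have V: "GDERIV V x :> gradient V x" for x
    using feas unfolding feasible_def by (blast intro: gderiv_gradient poly_differentiable)
  have nonincr: "gradient V x \<bullet> f x \<le> 0" if "x \<in> interior ?\<Omega>" for x
  proof -
    have x: "x \<in> ?\<Omega>" using that interior_subset by blast
    have "0 \<le> (x \<bullet> x) ^ d" by simp
    with lower[OF x] have "0 \<le> V x" by linarith
    then have "0 \<le> (2 * real d * k) * V x" using \<open>0 \<le> k\<close> by simp
    with decr[OF x] show ?thesis unfolding mult_minus_left by linarith
  qed
  have "norm (\<phi> x t) \<le> ?M * exp (- k * t) * norm x"
    if x: "x \<in> sublevel V c" and "0 \<le> t" for x t
  proof -
    have sol: "solves_ivp f x (\<phi> x)" using assms(3) by (simp add: solution_map_def)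
    have inv: "\<phi> x s \<in> ?\<Omega>" if "0 \<le> s" for s
      using sublevel_forward_invariant[OF sol V open_interior assms(8) nonincr x that]
        assms(8) interior_subset by blast
    have x': "x \<in> ?\<Omega>" using x assms(8) interior_subset by blast
    have norm_pow: "(y \<bullet> y) ^ d = norm y ^ (2 * d)" for y :: "real ^ 'n"
      by (simp add: power_mult power2_norm_eq_inner)
    have "?M ^ (2 * d) = ?M powr real (2 * d)"
      using \<open>1 \<le> \<gamma>\<close> by (subst powr_realpow) auto
    also have "\<dots> = \<gamma>" using \<open>1 \<le> \<gamma>\<close> \<open>1 \<le> d\<close> by (simp add: powr_powr)
    finally have M_pow: "?M ^ (2 * d) = \<gamma>" .
    have exp_pow: "exp (- k * t) ^ (2 * d) = exp (- (2 * real d * k) * t)"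
      by (simp add: exp_of_nat_mult[symmetric] algebra_simps)
    have "norm (\<phi> x t) ^ (2 * d) \<le> V (\<phi> x t)"
      using lower[OF inv[OF \<open>0 \<le> t\<close>]] by (simp only: norm_pow)
    also have "\<dots> \<le> exp (- (2 * real d * k) * t) * V x"
      using decr[OF inv] by (intro decay_along_solution[OF sol V _ \<open>0 \<le> t\<close>])
    also have "\<dots> \<le> exp (- (2 * real d * k) * t) * (\<gamma> * norm x ^ (2 * d))"
      using upper[OF x'] by (intro mult_left_mono) (auto simp only: norm_pow exp_ge_zero)
    also have "\<dots> = (?M * exp (- k * t) * norm x) ^ (2 * d)"
      unfolding power_mult_distrib M_pow exp_pow by (simp only: mult_ac)
    finally show ?thesis
      using \<open>1 \<le> d\<close> by (subst (asm) power_mono_iff) auto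
  qed
  with \<open>0 \<le> k\<close> \<open>1 \<le> ?M\<close> show ?thesis
    unfolding exponentially_stable_on_def by blast
qed

end
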